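(* Consider the regularized MPC closed loop described in the context. Assume that $V_{\mathrm{reg}}(X,U,t)$ is real-valued and differentiable with respect to $(X,U)$, and that its gradient $$\psi_t(X,U):=\nabla_UV_{\mathrm{reg}}(X,U,t)+\bar B^\top\nabla_XV_{\mathrm{reg}}(X,U,t)$$ is Lipschitz with respect to $(X,U)$, uniformly in $t$, with Lipschitz constant $L>0$. Assume also that, for any $x\in\mathbb{R}^n$ and $t\in\mathbb{N}$, the OCP admits a unique optimal solution and no other stationary points (a stationary point being a solution $U$ of $Cx+DU+\psi_t(\bar Ax+\bar BU,U)=0$). Let $\eta\in(0,1)$ and $\gamma=L^{-2}$. Suppose there exists a positive definite matrix $P\in\mathbb{R}^{n\times n}$ such that $$ \begin{bmatrix} A^\top P A-\eta^2 P & A^\top P B\Pi_1\\ \Pi_1^\top B^\top P A & \Pi_1^\top B^\top P B\Pi_1\end{bmatrix} +\begin{bmatrix}\bar A&\bar B\\ 0&I_{Hm}\\ -C&-D\end{bmatrix}^\top \begin{bmatrix}I_{Hn+Hm}&0\\ 0&-\gamma I_{Hm}\end{bmatrix} \begin{bmatrix}\bar A&\bar B\\ 0&I_{Hm}\\ -C&-D\end{bmatrix}\preceq 0 . $$ Then the closed-loop system is strongly contracting with respect to the norm $\|\cdot\|_P$ with factor $\eta$.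
   Context: Plant: $x(t+1)=Ax(t)+Bu(t)$, $t\in\mathbb{N}=\{0,1,2,\dots\}$, with $A\in\mathbb{R}^{n\times n}$, $B\in\mathbb{R}^{n\times m}$. Let $H\ge 1$ be an integer (prediction horizon), and let $Q,Q_{\mathrm f}\in\mathbb{R}^{n\times n}$, $R\in\mathbb{R}^{m\times m}$ be symmetric cost matrices; write $\|v\|_Q^2=v^\top Qv$ (similarly for the others). For a state $x$ and time $t$, the optimal control problem (OCP) is: minimize over $U=[u_1;\dots;u_H]\in\mathbb{R}^{Hm}$ (each $u_h\in\mathbb{R}^m$) $$\tfrac12\sum_{h=1}^{H}(\|x_h\|_Q^2+\|u_h\|_R^2)+\tfrac12\|x_{H+1}\|_{Q_{\mathrm f}}^2+V_{\mathrm{reg}}(X,U,t),$$ where $x_1=x$, $x_{h+1}=Ax_h+Bu_h$ for $h=1,\dots,H$, and $X=[x_2;\dots;x_{H+1}]\in\mathbb{R}^{Hn}$. Define $\bar A:=[A;A^2;\dots;A^H]\in\mathbb{R}^{Hn\times n}$ (vertical stacking); $\bar B\in\mathbb{R}^{Hn\times Hm}$ the block lower triangular matrix whose $(i,j)$ block is $A^{i-j}B$ for $i\ge j$ and $0$ for $i<j$; $\bar Q:=\mathrm{diag}(Q,\dots,Q,Q_{\mathrm f})$ with $H-1$ copies of $Q$; $\bar R:=\mathrm{diag}(R,\dots,R)$ with $H$ copies; $C:=\bar B^\top\bar Q\bar A$; $D:=\bar R+\bar B^\top\bar Q\bar B$. Up to terms independent of $U$, the OCP is $\min_U\ U^\top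 Cx+\tfrac12U^\top DU+V_{\mathrm{reg}}(\bar Ax+\bar BU,U,t)$. Let $U_t^\ast(x)$ be the unique optimal solution and $\Pi_1=[I_m\ 0]\in\mathbb{R}^{m\times Hm}$. The regularized MPC feedback is $u(t)=\Pi_1U_t^\ast(x(t))$; the closed loop is $x(t+1)=Ax(t)+B\Pi_1U^\ast_t(x(t))$. A system $x(t+1)=f_t(x(t))$ is strongly contracting with respect to $\|\cdot\|_P$ ($\|v\|_P=\sqrt{v^\top Pv}$, $P$ positive definite) with factor $\eta\in(0,1)$ if any two trajectories satisfy $\|x^{(1)}(t+1)-x^{(2)}(t+1)\|_P\le\eta\|x^{(1)}(t)-x^{(2)}(t)\|_P$ for all $t\in\mathbb{N}$. Positive definite matrices are symmetric; Lipschitz constants are with respect to Euclidean norms. *)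

theory Defs
  imports "HOL-Analysis.Analysis"
begin

text \<open>
  The prediction horizon \<open>H \<ge> 1\<close> is the cardinality of a finite linearly ordered index type
  \<open>'h\<close> (every \<open>H \<ge> 1\<close> occurs, e.g. as a numeral type).  A stacked vector of \<open>H\<close> blocks in
  \<open>\<real>^'k\<close> is an element of \<open>\<real>^('h \<times> 'k)\<close>, whose norm is the Euclidean norm.
  Stages are counted from 0: the block with \<open>pos h = k\<close> is block number \<open>k + 1\<close> in the usual
  notation \<open>u\<^sub>1, \<dots>, u\<^sub>H\<close>.
\<close>

definition pos :: "'h::{finite,linorder} \<Rightarrow> nat"
  where "pos h = card {..<h}"

definition stage :: "nat \<Rightarrow> 'h::{finite,linorder}"
  where "stage k = (THE h. pos h = k)"

definition block :: "real^('h::finite \<times> 'k::finite) \<Rightarrow> 'h \<Rightarrow> real^'k"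
  where "block U h = (\<chi> j. U $ (h, j))"


section \<open>Matrices\<close>

text \<open>The library operation \<open>^\<close> on square matrices would be a componentwise power.\<close>

primrec matpow :: "real^'n^'n \<Rightarrow> nat \<Rightarrow> real^'n^'n"
  where
    "matpow A 0 = mat 1"
  | "matpow A (Suc k) = A ** matpow A k"

definition vcat :: "real^'c^'r \<Rightarrow> real^'c^'s \<Rightarrow> real^'c^('r::finite + 's::finite)"
  where "vcat M N = (\<chi> i. case i of Inl r \<Rightarrow> M $ r | Inr s \<Rightarrow> N $ s)"

definition hcat :: "real^'c^'r \<Rightarrow> real^'d^'r \<Rightarrow> real^('c::finite + 'd::finite)^'r"
  where "hcat M N = (\<chi> i j. case j of Inl c \<Rightarrow> M $ i $ c | Inr d \<Rightarrow> N $ i $ d)"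

definition pos_def :: "real^'n^'n \<Rightarrow> bool"
  where "pos_def P \<longleftrightarrow> transpose P = P \<and> (\<forall>v. v \<noteq> 0 \<longrightarrow> 0 < v \<bullet> (P *v v))"

definition neg_semidef :: "real^'n^'n \<Rightarrow> bool"
  where "neg_semidef M \<longleftrightarrow> transpose M = M \<and> (\<forall>v. v \<bullet> (M *v v) \<le> 0)"

definition sqnorm_wrt :: "real^'n^'n \<Rightarrow> real^'n \<Rightarrow> real"
  where "sqnorm_wrt Q v = v \<bullet> (Q *v v)"

definition norm_wrt :: "real^'n^'n \<Rightarrow> real^'n \<Rightarrow> real"
  where "norm_wrt P v = sqrt (sqnorm_wrt P v)"


section \<open>Optimal control problem and regularized MPC\<close>

text \<open>\<open>pred_state A B x U k\<close> is the predicted state \<open>x\<^sub>k\<^sub>+\<^sub>1\<close>; in particular the terminal state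
  \<open>x\<^sub>H\<^sub>+\<^sub>1\<close> is \<open>pred_state A B x U CARD('h)\<close>.\<close>

primrec pred_state ::
  "real^'n^'n \<Rightarrow> real^'m^'n \<Rightarrow> real^'n \<Rightarrow> real^('h::{finite,linorder} \<times> 'm::finite) \<Rightarrow> nat \<Rightarrow> real^'n"
  where
    "pred_state A B x U 0 = x"
  | "pred_state A B x U (Suc k) = A *v pred_state A B x U k + B *v block U (stage k)"

definition pred_stack ::
  "real^'n^'n \<Rightarrow> real^'m^'n \<Rightarrow> real^'n \<Rightarrow> real^('h::{finite,linorder} \<times> 'm::finite)
    \<Rightarrow> real^('h \<times> 'n::finite)"
  where "pred_stack A B x U = (\<chi> p. pred_state A B x U (Suc (pos (fst p))) $ snd p)"

definition ocp_cost ::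
  "real^'n^'n \<Rightarrow> real^'m^'n \<Rightarrow> real^'n^'n \<Rightarrow> real^'n^'n \<Rightarrow> real^'m^'m
    \<Rightarrow> (real^('h \<times> 'n) \<Rightarrow> real^('h \<times> 'm) \<Rightarrow> nat \<Rightarrow> real)
    \<Rightarrow> real^'n \<Rightarrow> nat \<Rightarrow> real^('h::{finite,linorder} \<times> 'm::finite) \<Rightarrow> real"
  where "ocp_cost A B Q Qf R V x t U =
    1/2 * (\<Sum>h\<in>UNIV. sqnorm_wrt Q (pred_state A B x U (pos h)) + sqnorm_wrt R (block U h))
    + 1/2 * sqnorm_wrt Qf (pred_state A B x U CARD('h))
    + V (pred_stack A B x U) U t"

definition ocp_solution ::
  "real^'n^'n \<Rightarrow> real^'m^'n \<Rightarrow> real^'n^'n \<Rightarrow> real^'n^'n \<Rightarrow> real^'m^'m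
    \<Rightarrow> (real^('h \<times> 'n) \<Rightarrow> real^('h \<times> 'm) \<Rightarrow> nat \<Rightarrow> real)
    \<Rightarrow> real^'n \<Rightarrow> nat \<Rightarrow> real^('h::{finite,linorder} \<times> 'm::finite) \<Rightarrow> bool"
  where "ocp_solution A B Q Qf R V x t U \<longleftrightarrow>
    is_arg_min (ocp_cost A B Q Qf R V x t) (\<lambda>_. True) U"

definition ocp_opt ::
  "real^'n^'n \<Rightarrow> real^'m^'n \<Rightarrow> real^'n^'n \<Rightarrow> real^'n^'n \<Rightarrow> real^'m^'m
    \<Rightarrow> (real^('h \<times> 'n) \<Rightarrow> real^('h \<times> 'm) \<Rightarrow> nat \<Rightarrow> real)
    \<Rightarrow> nat \<Rightarrow> real^'n \<Rightarrow> real^('h::{finite,linorder} \<times> 'm::finite)"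
  where "ocp_opt A B Q Qf R V t x = (THE U. ocp_solution A B Q Qf R V x t U)"

definition Pi1 :: "real^('h::{finite,linorder} \<times> 'm::finite)^'m"
  where "Pi1 = (\<chi> i q. if pos (fst q) = 0 \<and> i = snd q then 1 else 0)"

definition mpc_closed_loop ::
  "real^'n^'n \<Rightarrow> real^'m^'n \<Rightarrow> real^'n^'n \<Rightarrow> real^'n^'n \<Rightarrow> real^'m^'m
    \<Rightarrow> (real^('h::{finite,linorder} \<times> 'n) \<Rightarrow> real^('h \<times> 'm::finite) \<Rightarrow> nat \<Rightarrow> real)
    \<Rightarrow> nat \<Rightarrow> real^'n \<Rightarrow> real^'n"
  where "mpc_closed_loop A B Q Qf R V t x =
    A *v x + B *v (Pi1 *v ocp_opt A B Q Qf R V t x)"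


section \<open>Condensed form\<close>

definition Abar :: "real^'n^'n \<Rightarrow> real^'n^('h::{finite,linorder} \<times> 'n)"
  where "Abar A = (\<chi> p j. matpow A (Suc (pos (fst p))) $ snd p $ j)"

definition Bbar ::
  "real^'n^'n \<Rightarrow> real^'m^'n \<Rightarrow> real^('h \<times> 'm::finite)^('h::{finite,linorder} \<times> 'n)"
  where "Bbar A B = (\<chi> p q.
    if fst q \<le> fst p then (matpow A (pos (fst p) - pos (fst q)) ** B) $ snd p $ snd q else 0)"

definition Qbar :: "real^'n^'n \<Rightarrow> real^'n^'n \<Rightarrow> real^('h \<times> 'n)^('h::{finite,linorder} \<times> 'n)"
  where "Qbar Q Qf = (\<chi> p q.
    if fst p = fst q
    then (if Suc (pos (fst p)) = CARD('h) then Qf else Q) $ snd p $ snd q else 0)"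

definition Rbar :: "real^'m^'m \<Rightarrow> real^('h \<times> 'm)^('h::finite \<times> 'm)"
  where "Rbar R = (\<chi> p q. if fst p = fst q then R $ snd p $ snd q else 0)"

definition Cmat ::
  "real^'n^'n \<Rightarrow> real^'m^'n \<Rightarrow> real^'n^'n \<Rightarrow> real^'n^'n
    \<Rightarrow> real^'n^('h::{finite,linorder} \<times> 'm::finite)"
  where "Cmat A B Q Qf =
    transpose (Bbar A B) ** (Qbar Q Qf :: real^('h \<times> 'n)^('h \<times> 'n)) ** Abar A"

definition Dmat ::
  "real^'n^'n \<Rightarrow> real^'m^'n \<Rightarrow> real^'n^'n \<Rightarrow> real^'n^'n \<Rightarrow> real^'m^'m
    \<Rightarrow> real^('h \<times> 'm)^('h::{finite,linorder} \<times> 'm::finite)"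
  where "Dmat A B Q Qf R =
    Rbar R + transpose (Bbar A B) ** (Qbar Q Qf :: real^('h \<times> 'n)^('h \<times> 'n)) ** Bbar A B"

definition grad :: "('a::real_inner \<Rightarrow> real) \<Rightarrow> 'a \<Rightarrow> 'a"
  where "grad f x = (THE g. GDERIV f x :> g)"

definition psi ::
  "real^'n^'n \<Rightarrow> real^'m^'n
    \<Rightarrow> (real^('h::{finite,linorder} \<times> 'n) \<Rightarrow> real^('h \<times> 'm::finite) \<Rightarrow> nat \<Rightarrow> real)
    \<Rightarrow> nat \<Rightarrow> real^('h \<times> 'n) \<Rightarrow> real^('h \<times> 'm) \<Rightarrow> real^('h \<times> 'm)"
  where "psi A B V t X U =
    grad (\<lambda>U'. V X U' t) U + transpose (Bbar A B) *v grad (\<lambda>X'. V X' U t) X"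

definition ocp_stationary ::
  "real^'n^'n \<Rightarrow> real^'m^'n \<Rightarrow> real^'n^'n \<Rightarrow> real^'n^'n \<Rightarrow> real^'m^'m
    \<Rightarrow> (real^('h \<times> 'n) \<Rightarrow> real^('h \<times> 'm) \<Rightarrow> nat \<Rightarrow> real)
    \<Rightarrow> real^'n \<Rightarrow> nat \<Rightarrow> real^('h::{finite,linorder} \<times> 'm::finite) \<Rightarrow> bool"
  where "ocp_stationary A B Q Qf R V x t U \<longleftrightarrow>
    Cmat A B Q Qf *v x + Dmat A B Q Qf R *v U + psi A B V t (Abar A *v x + Bbar A B *v U) U = 0"


section \<open>Contraction\<close>

definition strongly_contracting :: "(nat \<Rightarrow> real^'n \<Rightarrow> real^'n) \<Rightarrow> real^'n^'n \<Rightarrow> real \<Rightarrow> bool"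
  where "strongly_contracting f P \<eta> \<longleftrightarrow>
    (\<forall>x y. (\<forall>t. x (Suc t) = f t (x t)) \<and> (\<forall>t. y (Suc t) = f t (y t)) \<longrightarrow>
      (\<forall>t. norm_wrt P (x (Suc t) - y (Suc t)) \<le> \<eta> * norm_wrt P (x t - y t)))"

end

theory Submission
  imports Defs
begin

text \<open>
  Eliminating the states turns the optimal control problem into the unconstrained minimization of
  a quadratic in \<open>U\<close> plus \<open>V(X, U, t)\<close>, where \<open>X\<close> is affine in \<open>x\<close> and \<open>U\<close>.  Its gradient is
  \<open>C x + D U + \<psi>\<^sub>t(X, U)\<close> and vanishes at a minimizer.  Hence, for two states with difference \<open>d\<close>
  and the corresponding optimal inputs with difference \<open>w\<close>, the difference of the two values of
  \<open>\<psi>\<^sub>t\<close> equals \<open>- (C d + D w)\<close>, and the Lipschitz bound reads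
  \<open>\<gamma> \<parallel>C d + D w\<parallel>\<^sup>2 \<le> \<parallel>A\<^sub>H d + B\<^sub>H w\<parallel>\<^sup>2 + \<parallel>w\<parallel>\<^sup>2\<close>, with \<open>A\<^sub>H\<close>, \<open>B\<^sub>H\<close> the stacked prediction
  matrices: an incremental quadratic constraint on the nonlinearity.

  Evaluated at the stacked vector \<open>(d, w)\<close>, the first matrix of the linear matrix inequality
  yields \<open>\<parallel>A d + B \<Pi>\<^sub>1 w\<parallel>\<^sub>P\<^sup>2 - \<eta>\<^sup>2 \<parallel>d\<parallel>\<^sub>P\<^sup>2\<close>, the decrease to be proved, and the second
  one yields exactly the slack in the quadratic constraint, which is nonnegative
  (an S-procedure argument).  The sum being at most 0, so is the first term
  (\<open>lmi_quadratic_form\<close>, \<open>optimal_inputs_quadratic_constraint\<close>).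

  Most of the work is to identify the recursively defined cost with its condensed form
  (\<open>pred_stack_eq\<close>, \<open>ocp_cost_eq\<close>) and to derive stationarity of minimizers from joint
  differentiability of the regularizer (\<open>ocp_solution_imp_stationary\<close>).
\<close>


section \<open>Positions in the horizon\<close>

lemma pos_less_iff: "pos h < pos k \<longleftrightarrow> h < (k :: 'h::{finite,linorder})"
proof -
  have mono: "pos a < pos b" if "a < b" for a b :: 'h
    unfolding pos_def using that by (intro psubset_card_mono) auto
  show ?thesis
    using mono[of h k] mono[of k h] by (metis less_asym linorder_neqE)
qed

lemma pos_eq_iff: "pos h = pos k \<longleftrightarrow> h = (k :: 'h::{finite,linorder})"
  using pos_less_iff[of h k] pos_less_iff[of k h] by (metis linorder_neqE less_irrefl)

lemma pos_le_iff: "pos h \<le> pos k \<longleftrightarrow> h \<le> (k :: 'h::{finite,linorder})"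
  using pos_less_iff[of k h] by (simp add: not_less[symmetric])

lemma stage_pos [simp]: "stage (pos h) = h"
  unfolding stage_def by (simp add: pos_eq_iff)

lemma pos_less_CARD: "pos h < CARD('h)" for h :: "'h::{finite,linorder}"
  unfolding pos_def by (intro psubset_card_mono) auto

lemma bij_betw_pos: "bij_betw pos (UNIV :: 'h::{finite,linorder} set) {..<CARD('h)}"
proof -
  have inj: "inj (pos :: 'h \<Rightarrow> nat)"
    by (simp add: inj_def pos_eq_iff)
  have "range (pos :: 'h \<Rightarrow> nat) = {..<CARD('h)}"
    using card_image[OF inj] by (intro card_subset_eq) (auto simp: pos_less_CARD)
  with inj show ?thesis
    by (simp add: bij_betw_def)
qed

lemma bij_betw_pos_atMost: "bij_betw pos {..h} {..pos (h :: 'h::{finite,linorder})}"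
proof -
  have "i \<in> pos ` {..h}" if "i \<le> pos h" for i
  proof -
    have "i \<in> range (pos :: 'h \<Rightarrow> nat)"
      using bij_betw_pos[where 'h='h] that pos_less_CARD[of h] by (auto simp: bij_betw_def)
    with that show ?thesis
      by (auto simp: pos_le_iff)
  qed
  then show ?thesis
    by (auto simp: bij_betw_def inj_on_def pos_eq_iff pos_le_iff)
qed


section \<open>Stacked vectors and block matrices\<close>

lemma sum_UNIV_prod:
  "(\<Sum>p\<in>UNIV. f p) = (\<Sum>h\<in>UNIV. \<Sum>j\<in>UNIV. f (h :: 'h::finite, j :: 'k::finite))"
  by (simp add: sum.cartesian_product flip: UNIV_Times_UNIV)

lemma inner_eq_sum_block:
  "X \<bullet> Y = (\<Sum>h\<in>UNIV. block X h \<bullet> block Y h)" for X :: "real^('h::finite \<times> 'k::finite)"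
  by (simp add: inner_vec_def sum_UNIV_prod block_def)

lemma vec_eq_iff_block: "X = Y \<longleftrightarrow> (\<forall>h. block X h = block Y h)"
  by (auto simp: vec_eq_iff block_def)

lemma block_add: "block (X + Y) h = block X h + block Y h"
  by (simp add: block_def vec_eq_iff)

lemma block_mult_vec:
  fixes M :: "real^('h \<times> 'm::finite)^('h::finite \<times> 'k::finite)"
  assumes "\<And>i h' j. M $ (h, i) $ (h', j) = T h' $ i $ j"
  shows "block (M *v U) h = (\<Sum>h'\<in>UNIV. T h' *v block U (h' :: 'h::finite) :: real^'k)"
  by (simp add: vec_eq_iff block_def matrix_vector_mult_def sum_UNIV_prod assms)

lemma block_diagonal_mult_vec:
  fixes M :: "real^('h \<times> 'm::finite)^('h::finite \<times> 'k::finite)"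
  assumes "\<And>i h' j. M $ (h, i) $ (h', j) = (if h = h' then T $ i $ j else 0)"
  shows "block (M *v U) h = T *v block U h"
proof -
  have "block (M *v U) h = (\<Sum>h'\<in>UNIV. (if h' = h then T else 0) *v block U h')"
    using assms by (intro block_mult_vec) auto
  also have "\<dots> = (\<Sum>h'\<in>UNIV. if h' = h then T *v block U h' else 0)"
    by (intro sum.cong) auto
  finally show ?thesis
    by simp
qed

definition vjoin :: "real^'r \<Rightarrow> real^'s \<Rightarrow> real^('r::finite + 's::finite)"
  where "vjoin x y = (\<chi> i. case i of Inl r \<Rightarrow> x $ r | Inr s \<Rightarrow> y $ s)"

lemma sum_UNIV_sum:
  "(\<Sum>i\<in>UNIV. f i) = (\<Sum>r\<in>UNIV. f (Inl r)) + (\<Sum>s\<in>UNIV. f (Inr s))"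
  for f :: "'r::finite + 's::finite \<Rightarrow> real"
  by (simp add: UNIV_Plus_UNIV[symmetric] sum.Plus del: UNIV_Plus_UNIV)

lemma inner_vjoin: "vjoin x y \<bullet> vjoin x' y' = x \<bullet> x' + y \<bullet> y'"
  by (simp add: inner_vec_def vjoin_def sum_UNIV_sum)

lemma vcat_mult_vec: "vcat M N *v z = vjoin (M *v z) (N *v z)"
  by (auto simp: vec_eq_iff vcat_def vjoin_def matrix_vector_mult_def split: sum.split)

lemma hcat_mult_vjoin: "hcat M N *v vjoin x y = M *v x + N *v y"
  by (simp add: vec_eq_iff hcat_def vjoin_def matrix_vector_mult_def sum_UNIV_sum)

lemma inner_transpose_mult_vec: "x \<bullet> (transpose M *v y) = (M *v x) \<bullet> y"
  for M :: "real^'c^'r"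
  by (metis dot_lmul_matrix inner_commute transpose_matrix_vector)

lemma uminus_matrix_mult_vec: "(- M) *v x = - (M *v x)" for M :: "real^'c^'r"
  by (simp add: vec_eq_iff matrix_vector_mult_def sum_negf)


section \<open>Condensed form of the optimal control problem\<close>

lemma pred_state_eq:
  "pred_state A B x U k =
    matpow A k *v x + (\<Sum>j<k. (matpow A (k - Suc j) ** B) *v block U (stage j))"
proof (induction k)
  case 0
  then show ?case by simp
next
  case (Suc k)
  have "A *v (\<Sum>j<k. (matpow A (k - Suc j) ** B) *v block U (stage j)) =
      (\<Sum>j<k. (matpow A (Suc k - Suc j) ** B) *v block U (stage j))"
    by (simp add: linear_sum[OF matrix_vector_mul_linear] matrix_vector_mul_assoc
        matrix_mul_assoc Suc_diff_Suc flip: matpow.simps(2))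
  with Suc show ?case
    by (simp add: matrix_vector_right_distrib matrix_vector_mul_assoc)
qed

text \<open>
  In \<open>Bbar\<close> only the blocks \<open>h' \<le> h\<close> are nonzero, and \<open>pos\<close> maps them onto the inputs
  \<open>0, \<dots>, pos h\<close> that enter the variation-of-constants formula for the state at \<open>pos h + 1\<close>.
\<close>

lemma pred_stack_eq: "pred_stack A B x U = Abar A *v x + Bbar A B *v U"
  for U :: "real^('h::{finite,linorder} \<times> 'm::finite)"
proof -
  have "block (Bbar A B *v U) h =
      (\<Sum>j\<le>pos h. (matpow A (pos h - j) ** B) *v block U (stage j))" for h :: 'h
  proof -
    have "block (Bbar A B *v U) h =
        (\<Sum>h'\<in>UNIV. (if h' \<le> h then matpow A (pos h - pos h') ** B else 0) *v block U h')"
      by (intro block_mult_vec) (simp add: Bbar_def)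
    also have "\<dots> = (\<Sum>h'\<le>h. (matpow A (pos h - pos h') ** B) *v block U h')"
      by (intro sum.mono_neutral_cong_right) auto
    also have "\<dots> = (\<Sum>j\<le>pos h. (matpow A (pos h - j) ** B) *v block U (stage j))"
      using sum.reindex_bij_betw[OF bij_betw_pos_atMost[of h],
          of "\<lambda>j. (matpow A (pos h - j) ** B) *v block U (stage j)"]
      by simp
    finally show ?thesis .
  qed
  moreover have "block (Abar A *v x) h = matpow A (Suc (pos h)) *v x" for h :: 'h
    by (simp add: vec_eq_iff block_def Abar_def matrix_vector_mult_def)
  moreover have "block (pred_stack A B x U) h = pred_state A B x U (Suc (pos h))" for h
    by (simp add: vec_eq_iff block_def pred_stack_def)
  ultimately show ?thesis
    unfolding vec_eq_iff_block block_add
    by (simp only: pred_state_eq lessThan_Suc_atMost diff_Suc_Suc) simp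
qed

text \<open>
  The cost and the stacked vector index the states differently: the cost weighs the states at positions
  \<open>0, \<dots>, H - 1\<close> by \<open>Q\<close> and the one at position \<open>H\<close> by \<open>Qf\<close>, whereas the stack contains the
  positions \<open>1, \<dots>, H\<close>.  The shift leaves over the initial state, whose cost is independent of
  \<open>U\<close>.
\<close>

lemma ocp_cost_eq:
  fixes A :: "real^'n^'n" and B :: "real^'m^'n" and x :: "real^'n"
    and U :: "real^('h::{finite,linorder} \<times> 'm)"
  defines "X \<equiv> pred_stack A B x U"
  shows "ocp_cost A B Q Qf R V x t U =
    1/2 * (X \<bullet> (Qbar Q Qf *v X)) + 1/2 * (U \<bullet> (Rbar R *v U)) + 1/2 * sqnorm_wrt Q x + V X U t"
proof -
  define s where "s = pred_state A B x U"
  define q where "q k = sqnorm_wrt (if k = CARD('h) then Qf else Q) (s k)" for k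
  have bX: "block X h = s (Suc (pos h))" for h
    by (simp add: X_def s_def vec_eq_iff block_def pred_stack_def)
  have "block (Qbar Q Qf *v X) h =
      (if Suc (pos h) = CARD('h) then Qf else Q) *v block X h" for h
    by (intro block_diagonal_mult_vec) (simp add: Qbar_def)
  then have "X \<bullet> (Qbar Q Qf *v X) = (\<Sum>h\<in>(UNIV :: 'h set). q (Suc (pos h)))"
    unfolding inner_eq_sum_block by (simp add: bX q_def sqnorm_wrt_def)
  also have "\<dots> = (\<Sum>k<CARD('h). q (Suc k))"
    by (rule sum.reindex_bij_betw[OF bij_betw_pos])
  \<comment> \<open>Restore the initial state, to pass from the positions \<open>1, \<dots>, H\<close> to \<open>0, \<dots>, H\<close>.\<close>
  also have "\<dots> + q 0 = (\<Sum>k<CARD('h). q k) + q CARD('h)"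
    by (metis add.commute sum.lessThan_Suc sum.lessThan_Suc_shift)
  also have "(\<Sum>k<CARD('h). q k) = (\<Sum>h\<in>(UNIV :: 'h set). q (pos h))"
    by (rule sum.reindex_bij_betw[OF bij_betw_pos, symmetric])
  also have "\<dots> = (\<Sum>h\<in>(UNIV :: 'h set). sqnorm_wrt Q (s (pos h)))"
    by (simp add: q_def pos_less_CARD less_imp_neq)
  finally have states: "(\<Sum>h\<in>(UNIV :: 'h set). sqnorm_wrt Q (s (pos h))) + sqnorm_wrt Qf (s CARD('h))
      = X \<bullet> (Qbar Q Qf *v X) + sqnorm_wrt Q x"
    by (simp add: q_def s_def)
  have "block (Rbar R *v U) h = R *v block U h" for h
    by (intro block_diagonal_mult_vec) (simp add: Rbar_def)
  then have inputs: "U \<bullet> (Rbar R *v U) = (\<Sum>h\<in>UNIV. sqnorm_wrt R (block U h))"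
    unfolding inner_eq_sum_block by (simp add: sqnorm_wrt_def)
  show ?thesis
    using states inputs
    by (simp add: ocp_cost_def sum.distrib s_def X_def algebra_simps)
qed

lemma transpose_Qbar:
  assumes "transpose Q = Q" "transpose Qf = Qf"
  shows "transpose (Qbar Q Qf) = Qbar Q Qf"
proof -
  have "Q $ i $ j = Q $ j $ i" "Qf $ i $ j = Qf $ j $ i" for i j
    using assms by (metis transpose_def vec_lambda_beta)+
  then show ?thesis
    by (auto simp: vec_eq_iff transpose_def Qbar_def)
qed

lemma transpose_Rbar:
  assumes "transpose R = R"
  shows "transpose (Rbar R) = Rbar R"
proof -
  have "R $ i $ j = R $ j $ i" for i j
    using assms by (metis transpose_def vec_lambda_beta)
  then show ?thesis
    by (auto simp: vec_eq_iff transpose_def Rbar_def)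
qed


section \<open>Minimizers are stationary\<close>

lemma grad_eqI:
  assumes "GDERIV f x :> g"
  shows "grad f x = g"
proof -
  have "g' = g" if "GDERIV f x :> g'" for g'
  proof -
    have "(\<lambda>h. h \<bullet> g') = (\<lambda>h. h \<bullet> g)"
      using has_derivative_unique that assms unfolding gderiv_def by blast
    then show ?thesis
      using vector_eq_ldot[of g' g] by (simp add: fun_eq_iff)
  qed
  with assms show ?thesis
    unfolding grad_def by blast
qed

text \<open>
  The partial gradients are those of the restrictions to \<open>X\<close> and \<open>U\<close>; joint differentiability is
  what lets them determine the derivative along the direction \<open>(B\<^sub>H w, w)\<close>, in which both
  arguments move.
\<close>

lemma has_derivative_partial_grads:
  fixes f :: "'a::euclidean_space \<Rightarrow> 'b::euclidean_space \<Rightarrow> real"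
  assumes "(\<lambda>(x, y). f x y) differentiable (at (x, y))"
  shows "((\<lambda>(x, y). f x y) has_derivative
    (\<lambda>(v, w). v \<bullet> grad (\<lambda>x'. f x' y) x + w \<bullet> grad (\<lambda>y'. f x y') y)) (at (x, y))"
proof -
  obtain f' where f': "((\<lambda>(x, y). f x y) has_derivative f') (at (x, y))"
    using assms by (auto simp: differentiable_def)
  obtain gx gy where g: "adjoint f' 1 = (gx, gy)"
    by fastforce
  have "f' z = z \<bullet> (gx, gy)" for z
    using adjoint_works[OF has_derivative_linear[OF f'], of z 1] g by (simp add: inner_commute)
  then have f'_eq: "f' = (\<lambda>(v, w). v \<bullet> gx + w \<bullet> gy)"
    by auto
  have "((\<lambda>x'. (x', y)) has_derivative (\<lambda>v. (v, 0))) (at x)"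
    by (auto intro!: derivative_eq_intros)
  then have "((\<lambda>x'. (\<lambda>(x, y). f x y) (x', y)) has_derivative (\<lambda>v. f' (v, 0))) (at x)"
    using f' by (rule has_derivative_compose)
  then have "grad (\<lambda>x'. f x' y) x = gx"
    by (intro grad_eqI) (simp add: gderiv_def f'_eq)
  moreover
  have "((\<lambda>y'. (x, y')) has_derivative (\<lambda>w. (0, w))) (at y)"
    by (auto intro!: derivative_eq_intros)
  then have "((\<lambda>y'. (\<lambda>(x, y). f x y) (x, y')) has_derivative (\<lambda>w. f' (0, w))) (at y)"
    using f' by (rule has_derivative_compose)
  then have "grad (\<lambda>y'. f x y') y = gy"
    by (intro grad_eqI) (simp add: gderiv_def f'_eq)
  ultimately show ?thesis
    using f' by (simp add: f'_eq)
qed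

lemma has_derivative_quadratic_form:
  fixes M :: "real^'n^'n"
  assumes "transpose M = M" "(g has_derivative g') (at x)"
  shows "((\<lambda>x. 1/2 * (g x \<bullet> (M *v g x))) has_derivative (\<lambda>w. g' w \<bullet> (M *v g x))) (at x)"
proof -
  have "g x \<bullet> (M *v g' w) = g' w \<bullet> (M *v g x)" for w
    using inner_transpose_mult_vec[of "g x" M "g' w"] assms(1) by (simp add: inner_commute)
  moreover have "((\<lambda>x. M *v g x) has_derivative (\<lambda>w. M *v g' w)) (at x)"
    using bounded_linear.has_derivative[OF matrix_vector_mul_bounded_linear assms(2)] .
  ultimately show ?thesis
    by (auto intro!: derivative_eq_intros assms(2))
qed

lemma ocp_solution_imp_stationary:
  fixes A :: "real^'n^'n" and U :: "real^('h::{finite,linorder} \<times> 'm::finite)"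
  assumes sym: "transpose Q = Q" "transpose Qf = Qf" "transpose R = R"
    and diff: "\<And>X U. (\<lambda>(X, U). V X U t) differentiable (at (X, U))"
    and sol: "ocp_solution A B Q Qf R V x t U"
  shows "ocp_stationary A B Q Qf R V x t U"
proof -
  define g :: "real^('h \<times> 'm) \<Rightarrow> real^('h \<times> 'n)"
    where "g = (\<lambda>U. Abar A *v x + Bbar A B *v U)"
  define G where "G = Cmat A B Q Qf *v x + Dmat A B Q Qf R *v U + psi A B V t (g U) U"
  have g': "(g has_derivative (\<lambda>w. Bbar A B *v w)) (at U)"
    unfolding g_def by (auto intro!: derivative_eq_intros
      bounded_linear.has_derivative[OF matrix_vector_mul_bounded_linear])
  have cost: "ocp_cost A B Q Qf R V x t = (\<lambda>U. 1/2 * (g U \<bullet> (Qbar Q Qf *v g U))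
      + 1/2 * (U \<bullet> (Rbar R *v U)) + 1/2 * sqnorm_wrt Q x + V (g U) U t)"
    by (simp add: ocp_cost_eq pred_stack_eq g_def fun_eq_iff)
  have "((\<lambda>U. (g U, U)) has_derivative (\<lambda>w. (Bbar A B *v w, w))) (at U)"
    by (auto intro!: derivative_eq_intros g')
  from has_derivative_compose[OF this has_derivative_partial_grads[OF diff]]
  have V': "((\<lambda>U. V (g U) U t) has_derivative
      (\<lambda>w. (Bbar A B *v w) \<bullet> grad (\<lambda>X. V X U t) (g U) + w \<bullet> grad (\<lambda>U'. V (g U) U' t) U)) (at U)"
    by simp
  have "(ocp_cost A B Q Qf R V x t has_derivative
      (\<lambda>w. (Bbar A B *v w) \<bullet> (Qbar Q Qf *v g U) + w \<bullet> (Rbar R *v U) + 0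
        + ((Bbar A B *v w) \<bullet> grad (\<lambda>X. V X U t) (g U) + w \<bullet> grad (\<lambda>U'. V (g U) U' t) U))) (at U)"
    unfolding cost
    by (intro has_derivative_add has_derivative_const V' has_derivative_quadratic_form
        transpose_Qbar transpose_Rbar sym g' has_derivative_ident)
  \<comment> \<open>Moving the prediction matrix to the other side of the inner product exposes the gradient.\<close>
  moreover have "(\<lambda>w. (Bbar A B *v w) \<bullet> (Qbar Q Qf *v g U) + w \<bullet> (Rbar R *v U) + 0
        + ((Bbar A B *v w) \<bullet> grad (\<lambda>X. V X U t) (g U) + w \<bullet> grad (\<lambda>U'. V (g U) U' t) U))
      = (\<lambda>w. w \<bullet> G)"
    by (simp add: fun_eq_iff G_def g_def psi_def Cmat_def Dmat_def inner_add_right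
        matrix_vector_right_distrib matrix_vector_mult_add_rdistrib inner_transpose_mult_vec
        del: transpose_matrix_vector
        flip: matrix_vector_mul_assoc)
  ultimately have G: "(ocp_cost A B Q Qf R V x t has_derivative (\<lambda>w. w \<bullet> G)) (at U)"
    by simp
  have "\<forall>U'\<in>UNIV. ocp_cost A B Q Qf R V x t U \<le> ocp_cost A B Q Qf R V x t U'"
    using sol by (auto simp: ocp_solution_def is_arg_min_linorder)
  then have "(\<lambda>w. w \<bullet> G) = (\<lambda>w. 0)"
    using differential_zero_maxmin[OF UNIV_I open_UNIV G] by simp
  from fun_cong[OF this, of G] have "G = 0"
    by simp
  then show ?thesis
    by (simp add: ocp_stationary_def G_def g_def)
qed


section \<open>Contraction\<close>

text \<open>
  Stationarity at both points expresses the increment of \<open>\<psi>\<^sub>t\<close> linearly in the increments of the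
  state and of the input, so that the Lipschitz bound becomes a quadratic inequality in these.
\<close>

lemma optimal_inputs_quadratic_constraint:
  fixes x x' :: "real^'n" and U U' :: "real^('h::{finite,linorder} \<times> 'm::finite)"
  assumes lip: "L-lipschitz_on UNIV (\<lambda>(X, U). psi A B V t X U)"
    and stat: "ocp_stationary A B Q Qf R V x t U" "ocp_stationary A B Q Qf R V x' t U'"
  defines "d \<equiv> x - x'" and "w \<equiv> U - U'"
  shows "(norm (Cmat A B Q Qf *v d + Dmat A B Q Qf R *v w))\<^sup>2
    \<le> L\<^sup>2 * ((norm ((Abar A :: real^'n^('h \<times> 'n)) *v d + Bbar A B *v w))\<^sup>2 + (norm w)\<^sup>2)"
proof -
  define X X' :: "real^('h \<times> 'n)" where
    "X = Abar A *v x + Bbar A B *v U" and "X' = Abar A *v x' + Bbar A B *v U'"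
  have dX: "X - X' = Abar A *v d + Bbar A B *v w"
    by (simp add: X_def X'_def d_def w_def matrix_vector_mult_diff_distrib)
  have "Cmat A B Q Qf *v d + Dmat A B Q Qf R *v w
      = (Cmat A B Q Qf *v x + Dmat A B Q Qf R *v U)
        - (Cmat A B Q Qf *v x' + Dmat A B Q Qf R *v U')"
    by (simp add: d_def w_def matrix_vector_mult_diff_distrib)
  also have "\<dots> = psi A B V t X' U' - psi A B V t X U"
    using stat by (simp add: ocp_stationary_def X_def X'_def add_eq_0_iff2)
  finally have "norm (Cmat A B Q Qf *v d + Dmat A B Q Qf R *v w)
      = dist (psi A B V t X U) (psi A B V t X' U')"
    by (simp add: dist_norm norm_minus_commute)
  also have "\<dots> \<le> L * dist (X, U) (X', U')"
    using lipschitz_onD[OF lip, of "(X, U)" "(X', U')"] by simp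
  finally have "(norm (Cmat A B Q Qf *v d + Dmat A B Q Qf R *v w))\<^sup>2
      \<le> (L * dist (X, U) (X', U'))\<^sup>2"
    by (intro power_mono) auto
  also have "\<dots> = L\<^sup>2 * ((norm (X - X'))\<^sup>2 + (norm w)\<^sup>2)"
    by (simp add: power_mult_distrib dist_norm w_def norm_Pair)
  finally show ?thesis
    by (simp only: dX)
qed

text \<open>
  Reading the linear matrix inequality at a stacked vector: the first summand measures the
  contraction of \<open>d \<mapsto> A d + B E w\<close>, the second one the slack in the Lipschitz constraint.
  The identity is blockwise algebra, so the prediction matrices \<open>(M1, M2)\<close> and the cost matrices
  \<open>(M3, M4)\<close> are arbitrary.
\<close>

lemma lmi_quadratic_form:
  fixes A P :: "real^'n^'n" and B :: "real^'m^'n" and E :: "real^'k^'m"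
    and M1 :: "real^'n^'r" and M2 :: "real^'k^'r" and M3 :: "real^'n^'s" and M4 :: "real^'k^'s"
  shows "vjoin d w \<bullet>
      ((vcat
          (hcat (transpose A ** P ** A - c *\<^sub>R P) (transpose A ** P ** B ** E))
          (hcat (transpose E ** transpose B ** P ** A) (transpose E ** transpose B ** P ** B ** E))
        + transpose (vcat (vcat (hcat M1 M2) (hcat 0 (mat 1))) (hcat (- M3) (- M4)))
          ** vcat (hcat (mat 1) 0) (hcat 0 (- \<gamma> *\<^sub>R mat 1))
          ** vcat (vcat (hcat M1 M2) (hcat 0 (mat 1))) (hcat (- M3) (- M4))) *v vjoin d w)
    = sqnorm_wrt P (A *v d + B *v (E *v w)) - c * sqnorm_wrt P d
      + ((norm (M1 *v d + M2 *v w))\<^sup>2 + (norm w)\<^sup>2 - \<gamma> * (norm (M3 *v d + M4 *v w))\<^sup>2)"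
proof -
  have "- (\<gamma> *\<^sub>R mat 1) *v z = - (\<gamma> *\<^sub>R z)" for z :: "real^'s"
    by (simp add: scaleR_matrix_vector_assoc[symmetric] flip: scaleR_minus_left)
  then show ?thesis
    by (simp add: matrix_vector_mult_add_rdistrib inner_add_right inner_add_left vcat_mult_vec
        uminus_matrix_mult_vec
        hcat_mult_vjoin inner_vjoin inner_transpose_mult_vec matrix_vector_mult_diff_rdistrib
        scaleR_matrix_vector_assoc[symmetric] inner_diff_right inner_diff_left sqnorm_wrt_def
        matrix_vector_right_distrib power2_norm_eq_inner algebra_simps
        del: transpose_matrix_vector
        flip: matrix_vector_mul_assoc)
qed

theorem theorem3:
  fixes A Q Qf P :: "real^'n^'n"
    and B :: "real^'m^'n"
    and R :: "real^'m^'m"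
    and V :: "real^('h::{finite,linorder} \<times> 'n) \<Rightarrow> real^('h \<times> 'm) \<Rightarrow> nat \<Rightarrow> real"
    and L \<eta> \<gamma> :: real
  assumes symQ: "transpose Q = Q"
    and symQf: "transpose Qf = Qf"
    and symR: "transpose R = R"
    and diff: "\<And>X U t. (\<lambda>(X, U). V X U t) differentiable (at (X, U))"
    and L: "L > 0"
    and lip: "\<And>t. L-lipschitz_on UNIV (\<lambda>(X, U). psi A B V t X U)"
    and unique: "\<And>x t. \<exists>!U. ocp_solution A B Q Qf R V x t U"
    and stationary: "\<And>x t U. ocp_stationary A B Q Qf R V x t U \<Longrightarrow> ocp_solution A B Q Qf R V x t U"
    and eta: "0 < \<eta>" "\<eta> < 1"
    and gamma: "\<gamma> = 1 / L\<^sup>2"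
    and P: "pos_def P"
    and LMI:
      "neg_semidef
        (vcat
          (hcat (transpose A ** P ** A - \<eta>\<^sup>2 *\<^sub>R P)
                (transpose A ** P ** B ** (Pi1 :: real^('h \<times> 'm)^'m)))
          (hcat (transpose Pi1 ** transpose B ** P ** A)
                (transpose Pi1 ** transpose B ** P ** B ** Pi1))
        + transpose
            (vcat (vcat (hcat (Abar A :: real^'n^('h \<times> 'n)) (Bbar A B))
                        (hcat 0 (mat 1 :: real^('h \<times> 'm)^('h \<times> 'm))))
                  (hcat (- Cmat A B Q Qf :: real^'n^('h \<times> 'm)) (- Dmat A B Q Qf R)))
          ** vcat (hcat (mat 1) 0)
                  (hcat 0 (- \<gamma> *\<^sub>R mat 1))
          ** vcat (vcat (hcat (Abar A) (Bbar A B))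
                        (hcat 0 (mat 1)))
                  (hcat (- Cmat A B Q Qf) (- Dmat A B Q Qf R)))"
  shows "strongly_contracting (mpc_closed_loop A B Q Qf R V) P \<eta>"
proof -
  have sol: "ocp_solution A B Q Qf R V x t (ocp_opt A B Q Qf R V t x)" for x t
    unfolding ocp_opt_def by (rule theI') (rule unique)
  have step: "norm_wrt P (mpc_closed_loop A B Q Qf R V t x - mpc_closed_loop A B Q Qf R V t y)
      \<le> \<eta> * norm_wrt P (x - y)" for t x y
  proof -
    define d where "d = x - y"
    define w where "w = ocp_opt A B Q Qf R V t x - ocp_opt A B Q Qf R V t y"
    define slack where "slack = (norm ((Abar A :: real^'n^('h \<times> 'n)) *v d + Bbar A B *v w))\<^sup>2
      + (norm w)\<^sup>2 - \<gamma> * (norm (Cmat A B Q Qf *v d + Dmat A B Q Qf R *v w))\<^sup>2"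
    have stat: "ocp_stationary A B Q Qf R V x t (ocp_opt A B Q Qf R V t x)" for x
      by (rule ocp_solution_imp_stationary[OF symQ symQf symR diff sol])
    have "slack \<ge> 0"
      using optimal_inputs_quadratic_constraint[OF lip stat stat, of x y] L
      unfolding slack_def d_def w_def gamma by (simp add: field_simps)
    moreover have "sqnorm_wrt P (A *v d + B *v (Pi1 *v w)) - \<eta>\<^sup>2 * sqnorm_wrt P d + slack \<le> 0"
      using LMI[unfolded neg_semidef_def, THEN conjunct2, THEN spec, of "vjoin d w"]
      unfolding lmi_quadratic_form slack_def .
    ultimately have "sqnorm_wrt P (A *v d + B *v (Pi1 *v w)) \<le> \<eta>\<^sup>2 * sqnorm_wrt P d"
      by simp
    then have "norm_wrt P (A *v d + B *v (Pi1 *v w)) \<le> sqrt (\<eta>\<^sup>2 * sqnorm_wrt P d)"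
      unfolding norm_wrt_def by simp
    also have "\<dots> = \<eta> * norm_wrt P d"
      using eta by (simp add: norm_wrt_def real_sqrt_mult)
    also have "A *v d + B *v (Pi1 *v w)
        = mpc_closed_loop A B Q Qf R V t x - mpc_closed_loop A B Q Qf R V t y"
      by (simp add: mpc_closed_loop_def d_def w_def matrix_vector_mult_diff_distrib)
    finally show ?thesis
      by (simp add: d_def)
  qed
  then show ?thesis
    by (simp add: strongly_contracting_def)
qed

end
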